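(* For any $\lambda\in\omega+1$ (i.e., $\lambda\in\omega$ or $\lambda=\omega$) there is a structure $\mathcal{M}_\lambda$ such that $\mathrm{ind}_{\mathrm{rig}}(\mathcal{M}_\lambda)=\lambda$.
   Context: For a set $A$ in a structure $\mathcal{M}$ (with universe $M$), the index of rigidity of $\mathcal{M}$ over $A$, denoted $\mathrm{ind}_{\mathrm{rig}}(\mathcal{M}/A)$, is the supremum of the cardinalities of the sets of solutions of algebraic types $\mathrm{tp}(a/A)$ for $a\in M$ (a type is algebraic if it contains a formula with only finitely many solutions). One puts $\mathrm{ind}_{\mathrm{rig}}(\mathcal{M})=\mathrm{ind}_{\mathrm{rig}}(\mathcal{M}/\emptyset)$, with $\mathrm{ind}_{\mathrm{rig}}(\mathcal{M})=0$ if $\mathcal{M}$ does not have algebraic types $\mathrm{tp}(a)$ for $a\in M$. *)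

theory Defs
  imports Main "HOL-Library.Extended_Nat"
begin

text \<open>
  One-sorted first-order logic with equality. The signature is part of the structure, and only the
  symbols in \<open>fun_syms\<close> and \<open>rel_syms\<close> belong to it (constants are function symbols of arity 0), so
  empty and purely relational languages are covered for any choice of symbol types.
\<close>

record ('f, 'r) fo_signature =
  fun_syms :: "'f set"
  rel_syms :: "'r set"
  fun_arity :: "'f \<Rightarrow> nat"
  rel_arity :: "'r \<Rightarrow> nat"

record ('f, 'r, 'a) fo_structure = "('f, 'r) fo_signature" +
  universe :: "'a set"
  fun_interp :: "'f \<Rightarrow> 'a list \<Rightarrow> 'a"
  rel_interp :: "'r \<Rightarrow> 'a list set"

definition wf_structure :: "('f, 'r, 'a) fo_structure \<Rightarrow> bool" where
  "wf_structure M \<longleftrightarrow>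
     universe M \<noteq> {} \<and>
     (\<forall>f\<in>fun_syms M. \<forall>xs\<in>lists (universe M).
        length xs = fun_arity M f \<longrightarrow> fun_interp M f xs \<in> universe M) \<and>
     (\<forall>r\<in>rel_syms M. rel_interp M r \<subseteq> {xs \<in> lists (universe M). length xs = rel_arity M r})"

text \<open>
  Formulas of the language expanded by names for parameters: \<open>Param c\<close> is the constant symbol
  naming the element \<open>c\<close>.
\<close>

datatype ('f, 'a) fo_term =
    Var nat
  | Param 'a
  | App 'f "('f, 'a) fo_term list"

datatype ('f, 'r, 'a) fo_formula =
    Eq "('f, 'a) fo_term" "('f, 'a) fo_term"
  | Rel 'r "('f, 'a) fo_term list"
  | Neg "('f, 'r, 'a) fo_formula"
  | Conj "('f, 'r, 'a) fo_formula" "('f, 'r, 'a) fo_formula"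
  | Exi nat "('f, 'r, 'a) fo_formula"

primrec wf_term :: "('f, 'r, 'a) fo_structure \<Rightarrow> 'a set \<Rightarrow> ('f, 'a) fo_term \<Rightarrow> bool" where
  "wf_term M A (Var i) \<longleftrightarrow> True"
| "wf_term M A (Param c) \<longleftrightarrow> c \<in> A"
| "wf_term M A (App f ts) \<longleftrightarrow>
     f \<in> fun_syms M \<and> length ts = fun_arity M f \<and> list_all (wf_term M A) ts"

primrec wf_formula :: "('f, 'r, 'a) fo_structure \<Rightarrow> 'a set \<Rightarrow> ('f, 'r, 'a) fo_formula \<Rightarrow> bool" where
  "wf_formula M A (Eq s t) \<longleftrightarrow> wf_term M A s \<and> wf_term M A t"
| "wf_formula M A (Rel r ts) \<longleftrightarrow>
     r \<in> rel_syms M \<and> length ts = rel_arity M r \<and> list_all (wf_term M A) ts"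
| "wf_formula M A (Neg \<phi>) \<longleftrightarrow> wf_formula M A \<phi>"
| "wf_formula M A (Conj \<phi> \<psi>) \<longleftrightarrow> wf_formula M A \<phi> \<and> wf_formula M A \<psi>"
| "wf_formula M A (Exi i \<phi>) \<longleftrightarrow> wf_formula M A \<phi>"

primrec term_vars :: "('f, 'a) fo_term \<Rightarrow> nat set" where
  "term_vars (Var i) = {i}"
| "term_vars (Param c) = {}"
| "term_vars (App f ts) = \<Union> (set (map term_vars ts))"

primrec free_vars :: "('f, 'r, 'a) fo_formula \<Rightarrow> nat set" where
  "free_vars (Eq s t) = term_vars s \<union> term_vars t"
| "free_vars (Rel r ts) = \<Union> (set (map term_vars ts))"
| "free_vars (Neg \<phi>) = free_vars \<phi>"
| "free_vars (Conj \<phi> \<psi>) = free_vars \<phi> \<union> free_vars \<psi>"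
| "free_vars (Exi i \<phi>) = free_vars \<phi> - {i}"

primrec term_val :: "('f, 'r, 'a) fo_structure \<Rightarrow> (nat \<Rightarrow> 'a) \<Rightarrow> ('f, 'a) fo_term \<Rightarrow> 'a" where
  "term_val M e (Var i) = e i"
| "term_val M e (Param c) = c"
| "term_val M e (App f ts) = fun_interp M f (map (term_val M e) ts)"

primrec sat :: "('f, 'r, 'a) fo_structure \<Rightarrow> (nat \<Rightarrow> 'a) \<Rightarrow> ('f, 'r, 'a) fo_formula \<Rightarrow> bool" where
  "sat M e (Eq s t) \<longleftrightarrow> term_val M e s = term_val M e t"
| "sat M e (Rel r ts) \<longleftrightarrow> map (term_val M e) ts \<in> rel_interp M r"
| "sat M e (Neg \<phi>) \<longleftrightarrow> \<not> sat M e \<phi>"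
| "sat M e (Conj \<phi> \<psi>) \<longleftrightarrow> sat M e \<phi> \<and> sat M e \<psi>"
| "sat M e (Exi i \<phi>) \<longleftrightarrow> (\<exists>b\<in>universe M. sat M (e(i := b)) \<phi>)"

text \<open>
  The free variable of a 1-type is variable 0. For a formula with no other free variable, the
  constant assignment below evaluates it at \<open>a\<close>.
\<close>

definition holds_at :: "('f, 'r, 'a) fo_structure \<Rightarrow> ('f, 'r, 'a) fo_formula \<Rightarrow> 'a \<Rightarrow> bool" where
  "holds_at M \<phi> a \<longleftrightarrow> sat M (\<lambda>_. a) \<phi>"

definition tp :: "('f, 'r, 'a) fo_structure \<Rightarrow> 'a set \<Rightarrow> 'a \<Rightarrow> ('f, 'r, 'a) fo_formula set" where
  "tp M A a = {\<phi>. wf_formula M A \<phi> \<and> free_vars \<phi> \<subseteq> {0} \<and> holds_at M \<phi> a}"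

definition solutions :: "('f, 'r, 'a) fo_structure \<Rightarrow> ('f, 'r, 'a) fo_formula set \<Rightarrow> 'a set" where
  "solutions M p = {b \<in> universe M. \<forall>\<phi>\<in>p. holds_at M \<phi> b}"

definition algebraic_type :: "('f, 'r, 'a) fo_structure \<Rightarrow> ('f, 'r, 'a) fo_formula set \<Rightarrow> bool" where
  "algebraic_type M p \<longleftrightarrow> (\<exists>\<phi>\<in>p. finite {b \<in> universe M. holds_at M \<phi> b})"

lemma finite_solutions_algebraic:
  assumes "algebraic_type M p"
  shows "finite (solutions M p)"
proof -
  obtain \<phi> where \<phi>: "\<phi> \<in> p" "finite {b \<in> universe M. holds_at M \<phi> b}"
    using assms by (auto simp: algebraic_type_def)
  have "solutions M p \<subseteq> {b \<in> universe M. holds_at M \<phi> b}"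
    using \<phi>(1) by (auto simp: solutions_def)
  then show ?thesis
    using \<phi>(2) by (rule finite_subset)
qed

text \<open>
  The index of rigidity of \<open>M\<close> over \<open>A\<close>. By the lemma above \<open>card\<close> is only applied to finite sets,
  so all cardinalities involved are natural numbers and the supremum lies in \<open>\<omega> + 1\<close>, rendered as
  \<^typ>\<open>enat\<close> with \<open>\<infinity>\<close> for \<open>\<omega>\<close>.
\<close>

definition ind_rig_over :: "('f, 'r, 'a) fo_structure \<Rightarrow> 'a set \<Rightarrow> enat" where
  "ind_rig_over M A =
     Sup {enat (card (solutions M (tp M A a))) | a. a \<in> universe M \<and> algebraic_type M (tp M A a)}"

definition ind_rig :: "('f, 'r, 'a) fo_structure \<Rightarrow> enat" where
  "ind_rig M = ind_rig_over M {}"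

lemma ind_rig_no_algebraic_types:
  assumes "\<And>a. a \<in> universe M \<Longrightarrow> \<not> algebraic_type M (tp M {} a)"
  shows "ind_rig M = 0"
proof -
  have "{enat (card (solutions M (tp M {} a))) | a. a \<in> universe M \<and> algebraic_type M (tp M {} a)} = {}"
    using assms by blast
  then show ?thesis
    by (simp add: ind_rig_def ind_rig_over_def Sup_enat_def)
qed

end

theory Submission
  imports Defs "HOL-Library.Nat_Bijection"
begin

text \<open>
  The structures are sets whose elements are coloured, with one unary predicate per colour.
  Every permutation that preserves colours is an automorphism of such a structure, so two elements
  of the same colour, being exchanged by a transposition, have the same type; elements of different
  colours are separated by the predicates. The set of solutions of a type over \<open>\<emptyset>\<close> is thus a colour
  class, and the type is algebraic exactly when that class is finite. Consequently the index of
  rigidity is the supremum of the sizes of the finite colour classes (\<open>ind_rig_coloured\<close>), and it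
  remains to colour the natural numbers suitably. A class with \<open>n\<close> elements and an infinite
  complement of a second colour gives \<open>n\<close>; for \<open>n = 0\<close> the finite class is empty, no type is
  algebraic, and the supremum is \<open>0\<close>. Finite classes of unbounded size give \<open>\<omega>\<close>.
\<close>

definition automorphism_over ::
  "('f, 'r, 'a) fo_structure \<Rightarrow> 'a set \<Rightarrow> ('a \<Rightarrow> 'a) \<Rightarrow> bool" where
  "automorphism_over M A g \<longleftrightarrow>
     bij_betw g (universe M) (universe M) \<and>
     (\<forall>c\<in>A. g c = c) \<and>
     (\<forall>f\<in>fun_syms M. \<forall>xs\<in>lists (universe M). length xs = fun_arity M f \<longrightarrow>
        fun_interp M f (map g xs) = g (fun_interp M f xs)) \<and>
     (\<forall>r\<in>rel_syms M. \<forall>xs\<in>lists (universe M). length xs = rel_arity M r \<longrightarrow>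
        (map g xs \<in> rel_interp M r \<longleftrightarrow> xs \<in> rel_interp M r))"

lemma term_val_in_universe:
  assumes "wf_structure M" "A \<subseteq> universe M" "range e \<subseteq> universe M" "wf_term M A t"
  shows "term_val M e t \<in> universe M"
  using assms(4)
proof (induction t)
  case (App f ts)
  then have "map (term_val M e) ts \<in> lists (universe M)" "length ts = fun_arity M f"
      "f \<in> fun_syms M"
    by (auto simp: list_all_iff)
  then show ?case
    using assms(1) by (simp add: wf_structure_def del: lists_eq_set)
qed (use assms in auto)

lemma term_val_automorphism:
  assumes "wf_structure M" "A \<subseteq> universe M" "automorphism_over M A g"
    and "range e \<subseteq> universe M" "wf_term M A t"
  shows "term_val M (g \<circ> e) t = g (term_val M e t)"
  using assms(5)
proof (induction t)
  case (App f ts)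
  have args: "map (term_val M e) ts \<in> lists (universe M)" "length ts = fun_arity M f"
      "f \<in> fun_syms M"
    using App.prems term_val_in_universe[OF assms(1,2,4)] by (auto simp: list_all_iff)
  have "map (term_val M (g \<circ> e)) ts = map g (map (term_val M e) ts)"
    using App by (simp add: list_all_iff comp_def)
  then show ?case
    using assms(3) args by (simp add: automorphism_over_def comp_def del: map_map lists_eq_set)
qed (use assms(3) in \<open>auto simp: automorphism_over_def\<close>)

text \<open>
  Injectivity of the automorphism serves the equations, its surjectivity the quantifiers: every
  witness \<open>b\<close> for the transported assignment has the form \<open>g b'\<close>. The assignment must be
  universally quantified in the induction, because a quantifier changes its values.
\<close>

lemma sat_automorphism:
  assumes "wf_structure M" "A \<subseteq> universe M" "automorphism_over M A g"
    and "range e \<subseteq> universe M" "wf_formula M A \<phi>"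
  shows "sat M (g \<circ> e) \<phi> \<longleftrightarrow> sat M e \<phi>"
  using assms(4,5)
proof (induction \<phi> arbitrary: e)
  case (Eq s t)
  have "inj_on g (universe M)"
    using assms(3) by (simp add: automorphism_over_def bij_betw_def)
  then show ?case
    using Eq term_val_automorphism[OF assms(1-3)] term_val_in_universe[OF assms(1,2)]
    by (simp add: inj_on_eq_iff comp_def)
next
  case (Rel r ts)
  have args: "map (term_val M e) ts \<in> lists (universe M)" "length ts = rel_arity M r"
      "r \<in> rel_syms M"
    using Rel term_val_in_universe[OF assms(1,2)] by (auto simp: list_all_iff)
  have "map (term_val M (g \<circ> e)) ts = map g (map (term_val M e) ts)"
    using Rel term_val_automorphism[OF assms(1-3)] by (simp add: list_all_iff)
  then show ?case
    using assms(3) args by (simp add: automorphism_over_def comp_def del: map_map lists_eq_set)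
next
  case (Exi i \<phi>)
  have img: "g ` universe M = universe M"
    using assms(3) by (simp add: automorphism_over_def bij_betw_def)
  have step: "sat M ((g \<circ> e)(i := g b)) \<phi> \<longleftrightarrow> sat M (e(i := b)) \<phi>" if "b \<in> universe M" for b
  proof -
    have "range (e(i := b)) \<subseteq> universe M"
      using Exi.prems(1) that by auto
    moreover have "(g \<circ> e)(i := g b) = g \<circ> e(i := b)"
      by auto
    ultimately show ?thesis
      using Exi.IH[of "e(i := b)"] Exi.prems(2) by (metis wf_formula.simps(5))
  qed
  have "sat M (g \<circ> e) (Exi i \<phi>) \<longleftrightarrow> (\<exists>b\<in>g ` universe M. sat M ((g \<circ> e)(i := b)) \<phi>)"
    by (simp add: img)
  also have "\<dots> \<longleftrightarrow> sat M e (Exi i \<phi>)"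
    using step by auto
  finally show ?case .
qed auto

text \<open>The lower bound for sets of solutions: the orbit of a realisation consists of realisations.\<close>

lemma automorphism_in_solutions_tp:
  assumes "wf_structure M" "A \<subseteq> universe M" "automorphism_over M A g" "a \<in> universe M"
  shows "g a \<in> solutions M (tp M A a)"
proof -
  have "holds_at M \<phi> (g a)" if "\<phi> \<in> tp M A a" for \<phi>
    using that sat_automorphism[OF assms(1-3), of "\<lambda>_. a" \<phi>] assms(4)
    by (auto simp: tp_def holds_at_def comp_def)
  moreover have "g a \<in> universe M"
    using assms(3,4) by (auto simp: automorphism_over_def bij_betw_def)
  ultimately show ?thesis
    by (simp add: solutions_def)
qed

definition coloured_structure :: "('a \<Rightarrow> 'r) \<Rightarrow> ('f, 'r, 'a) fo_structure" where
  "coloured_structure c =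
     \<lparr>fun_syms = {}, rel_syms = UNIV, fun_arity = (\<lambda>_. 0), rel_arity = (\<lambda>_. 1),
      universe = UNIV, fun_interp = (\<lambda>_ _. undefined),
      rel_interp = (\<lambda>k. {[x] | x. c x = k})\<rparr>"

lemma universe_coloured_structure [simp]: "universe (coloured_structure c) = UNIV"
  by (simp add: coloured_structure_def)

lemma wf_coloured_structure: "wf_structure (coloured_structure c)"
  by (auto simp: wf_structure_def coloured_structure_def)

lemma colour_formula_in_tp:
  "Rel (c a) [Var 0] \<in> tp (coloured_structure c) A a"
  by (simp add: tp_def holds_at_def coloured_structure_def)

lemma holds_at_colour_formula:
  "holds_at (coloured_structure c) (Rel k [Var 0]) b \<longleftrightarrow> c b = k"
  by (simp add: holds_at_def coloured_structure_def)

lemma transpose_automorphism_coloured: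
  assumes "c a = c b"
  shows "automorphism_over (coloured_structure c) {} (id(a := b, b := a))"
proof -
  let ?g = "id(a := b, b := a)"
  have invol: "?g (?g x) = x" for x
    by auto
  have pres: "c (?g x) = c x" for x
    using assms by auto
  have bij: "bij ?g"
    using invol by (rule involuntory_imp_bij)
  have "map ?g xs \<in> {[x] | x. c x = k} \<longleftrightarrow> xs \<in> {[x] | x. c x = k}" if "length xs = 1" for xs k
    using that pres by (auto simp: length_Suc_conv simp del: fun_upd_apply)
  with bij show ?thesis
    by (simp add: automorphism_over_def coloured_structure_def del: fun_upd_apply)
qed

lemma solutions_tp_coloured:
  "solutions (coloured_structure c) (tp (coloured_structure c) {} a) = {b. c b = c a}"
    (is "solutions ?M _ = _")
proof
  show "solutions ?M (tp ?M {} a) \<subseteq> {b. c b = c a}"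
    using colour_formula_in_tp holds_at_colour_formula by (fastforce simp: solutions_def)
  show "{b. c b = c a} \<subseteq> solutions ?M (tp ?M {} a)"
  proof safe
    fix b assume "c b = c a"
    then have "(id(a := b, b := a)) a \<in> solutions ?M (tp ?M {} a)"
      by (intro automorphism_in_solutions_tp wf_coloured_structure transpose_automorphism_coloured)
        auto
    then show "b \<in> solutions ?M (tp ?M {} a)"
      by (simp split: if_splits)
  qed
qed

lemma algebraic_tp_coloured_iff:
  "algebraic_type (coloured_structure c) (tp (coloured_structure c) {} a) \<longleftrightarrow> finite {b. c b = c a}"
    (is "algebraic_type ?M _ \<longleftrightarrow> _")
proof
  assume "algebraic_type ?M (tp ?M {} a)"
  then show "finite {b. c b = c a}"
    using finite_solutions_algebraic solutions_tp_coloured by metis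
next
  assume "finite {b. c b = c a}"
  then show "algebraic_type ?M (tp ?M {} a)"
    unfolding algebraic_type_def
    by (intro bexI[OF _ colour_formula_in_tp]) (simp add: holds_at_colour_formula)
qed

text \<open>
  This reduces the index of rigidity to combinatorics. The supremum runs over elements \<open>a\<close>, hence
  over nonempty colour classes only.
\<close>

lemma ind_rig_coloured:
  "ind_rig (coloured_structure c) = Sup {enat (card {b. c b = c a}) | a. finite {b. c b = c a}}"
  by (simp add: ind_rig_def ind_rig_over_def solutions_tp_coloured algebraic_tp_coloured_iff)

text \<open>
  The elements from \<open>n\<close> on form an infinite class, so their type is not algebraic and contributes
  nothing. This leaves the single value \<open>n\<close>, or no value at all if \<open>n = 0\<close>.
\<close>

lemma ind_rig_single_finite_colour:
  "ind_rig (coloured_structure (\<lambda>x::nat. of_bool (x < n) :: nat)) = enat n"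
proof -
  let ?c = "\<lambda>x::nat. of_bool (x < n) :: nat"
  have small: "{b. ?c b = ?c a} = {..<n}" if "a < n" for a
    using that by auto
  have large: "infinite {b. ?c b = ?c a}" if "\<not> a < n" for a
  proof -
    have "{b. ?c b = ?c a} = {n..}"
      using that by auto
    then show ?thesis
      by (simp add: infinite_Ici)
  qed
  have "{enat (card {b. ?c b = ?c a}) | a. finite {b. ?c b = ?c a}} = {enat n | a. a < n}"
  proof -
    have "finite {b. ?c b = ?c a} \<longleftrightarrow> a < n" for a
      using small large by (metis finite_lessThan)
    then show ?thesis
      using small by (metis (no_types, lifting) card_lessThan)
  qed
  also have "\<dots> = (if n = 0 then {} else {enat n})"
    by auto
  also have "Sup \<dots> = enat n"
    by (simp add: Sup_enat_def zero_enat_def)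
  finally show ?thesis
    by (simp add: ind_rig_coloured)
qed

lemma ind_rig_unbounded_finite_colours:
  assumes "\<And>a. finite {b. c b = c a}" and "\<And>n. \<exists>a. n \<le> card {b. c b = c a}"
  shows "ind_rig (coloured_structure c) = \<infinity>"
proof -
  have "enat n \<le> ind_rig (coloured_structure c)" for n
  proof -
    obtain a where "n \<le> card {b. c b = c a}"
      using assms(2) by blast
    then have "enat n \<le> enat (card {b. c b = c a})"
      by simp
    also have "\<dots> \<le> ind_rig (coloured_structure c)"
      unfolding ind_rig_coloured using assms(1) by (intro Sup_upper) auto
    finally show ?thesis .
  qed
  then show ?thesis
    by (metis Suc_ile_eq enat.exhaust less_irrefl)
qed

text \<open>
  The antidiagonals of \<open>\<nat> \<times> \<nat>\<close>, transported to the natural numbers by the pairing function, are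
  finite classes of unbounded size.
\<close>

definition antidiagonal :: "nat \<Rightarrow> nat" where
  "antidiagonal x = (case prod_decode x of (i, j) \<Rightarrow> i + j)"

lemma antidiagonal_class:
  "{x. antidiagonal x = k} = (\<lambda>i. prod_encode (i, k - i)) ` {..k}"
proof safe
  fix x assume "k = antidiagonal x"
  moreover obtain i j where "prod_decode x = (i, j)"
    by fastforce
  moreover from this have "x = prod_encode (i, j)"
    by (metis prod_decode_inverse)
  ultimately show "x \<in> (\<lambda>i. prod_encode (i, antidiagonal x - i)) ` {..antidiagonal x}"
    by (auto simp: antidiagonal_def intro!: image_eqI[where x = i])
qed (auto simp: antidiagonal_def)

lemma card_antidiagonal_class: "card {x. antidiagonal x = k} = Suc k"
  unfolding antidiagonal_class by (subst card_image) (auto intro: inj_onI)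

lemma ind_rig_antidiagonal: "ind_rig (coloured_structure antidiagonal) = \<infinity>"
proof (rule ind_rig_unbounded_finite_colours)
  show "finite {b. antidiagonal b = antidiagonal a}" for a
    by (simp add: antidiagonal_class)
  show "\<exists>a. n \<le> card {b. antidiagonal b = antidiagonal a}" for n
  proof
    have "antidiagonal (prod_encode (n, 0)) = n"
      by (simp add: antidiagonal_def)
    then show "n \<le> card {b. antidiagonal b = antidiagonal (prod_encode (n, 0))}"
      by (simp add: card_antidiagonal_class)
  qed
qed

theorem proposition3p3:
  fixes l :: enat
  shows "\<exists>M :: (nat, nat, nat) fo_structure. wf_structure M \<and> ind_rig M = l"
proof (cases l)
  case (enat n)
  then show ?thesis
    using wf_coloured_structure ind_rig_single_finite_colour by metis
next
  case infinity
  then show ?thesis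
    using wf_coloured_structure ind_rig_antidiagonal by metis
qed

end
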